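(* Let $M$ be a monoid and let $\Sigma$ and $\Delta$ be two finite subsets of $M$, each of which generates the whole monoid $M$. Then $\mathcal{E}_{d^\lambda_\Sigma}=\mathcal{E}_{d^\lambda_\Delta}$ and $\mathcal{E}_{d^\rho_\Sigma}=\mathcal{E}_{d^\rho_\Delta}$.
   Context: A subset $\Sigma$ of a monoid $M$ generates $M$ if every $g\in M$ can be written as $g=\sigma_1\cdots\sigma_n$ with $n\in\mathbb{N}$ and $\sigma_1,\dots,\sigma_n\in\Sigma$ (here $0\in\mathbb{N}$ and the empty product is the neutral element $e$). For such a finite $\Sigma$, define extended quasi-metrics $d^\lambda_\Sigma,d^\rho_\Sigma\colon M\times M\to\mathbb{N}\cup\{\infty\}$ by $$d^\lambda_\Sigma(x,y)=\min\{n\in\mathbb{N}\mid \exists\sigma_1,\dots,\sigma_n\in\Sigma:\ y=x\sigma_1\cdots\sigma_n\},\qquad d^\rho_\Sigma(x,y)=\min\{n\in\mathbb{N}\mid \exists\sigma_1,\dots,\sigma_n\in\Sigma:\ y=\sigma_1\cdots\sigma_n x\},$$ with $\min\emptyset=\infty$. For a map $d\colon X\times X\to[0,\infty]$ with $d(x,x)=0$ for all $x$, the family $\mathcal{E}_d$ consists of all subsets of the sets $E_R=\{(x,y)\in X\times X\mid d(x,y)\le R\}$, where $R$ ranges over the real numbers $R\geq 0$. *)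

theory Defs
  imports "HOL-Algebra.Group" "HOL-Library.Extended_Nonnegative_Real"
begin

definition list_mult :: "('a, 'b) monoid_scheme \<Rightarrow> 'a list \<Rightarrow> 'a" where
  "list_mult M \<sigma>s = foldr (mult M) \<sigma>s (one M)"

definition generates :: "('a, 'b) monoid_scheme \<Rightarrow> 'a set \<Rightarrow> bool" where
  "generates M \<Sigma> \<longleftrightarrow>
     \<Sigma> \<subseteq> carrier M \<and> (\<forall>g\<in>carrier M. \<exists>\<sigma>s\<in>lists \<Sigma>. g = list_mult M \<sigma>s)"

text \<open>
  The infimum of a nonempty set of extended naturals is its minimum, and the
  infimum of the empty set is \<open>\<infinity>\<close>, so \<open>Inf\<close> on \<open>enat\<close> realises the minimum with
  the convention that the empty set has minimum \<open>\<infinity>\<close>.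
\<close>

definition left_word_dist :: "('a, 'b) monoid_scheme \<Rightarrow> 'a set \<Rightarrow> 'a \<Rightarrow> 'a \<Rightarrow> enat" where
  "left_word_dist M \<Sigma> x y =
     Inf {enat (length \<sigma>s) | \<sigma>s. \<sigma>s \<in> lists \<Sigma> \<and> y = x \<otimes>\<^bsub>M\<^esub> list_mult M \<sigma>s}"

definition right_word_dist :: "('a, 'b) monoid_scheme \<Rightarrow> 'a set \<Rightarrow> 'a \<Rightarrow> 'a \<Rightarrow> enat" where
  "right_word_dist M \<Sigma> x y =
     Inf {enat (length \<sigma>s) | \<sigma>s. \<sigma>s \<in> lists \<Sigma> \<and> y = list_mult M \<sigma>s \<otimes>\<^bsub>M\<^esub> x}"

definition entourage :: "'a set \<Rightarrow> ('a \<Rightarrow> 'a \<Rightarrow> ennreal) \<Rightarrow> real \<Rightarrow> ('a \<times> 'a) set" where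
  "entourage X d R = {(x, y) \<in> X \<times> X. d x y \<le> ennreal R}"

definition coarse_family :: "'a set \<Rightarrow> ('a \<Rightarrow> 'a \<Rightarrow> ennreal) \<Rightarrow> ('a \<times> 'a) set set" where
  "coarse_family X d = {E. \<exists>R\<ge>0. E \<subseteq> entourage X d R}"

end

theory Submission
  imports Defs
begin

text \<open>
  Only finitely many \<open>\<Delta>\<close>-words are needed to express the elements of \<open>\<Sigma>\<close>; if \<open>L\<close> bounds their
  lengths, then substituting them letter by letter turns a \<open>\<Sigma>\<close>-word of length \<open>n\<close> into a
  \<open>\<Delta>\<close>-word of length at most \<open>L n\<close> with the same value. So the two word distances are
  bi-Lipschitz equivalent, on either side.
\<close>

lemma list_mult_simps [simp]:
  "list_mult M [] = \<one>\<^bsub>M\<^esub>"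
  "list_mult M (x # xs) = x \<otimes>\<^bsub>M\<^esub> list_mult M xs"
  by (simp_all add: list_mult_def)

context monoid
begin

lemma list_mult_closed [simp]:
  "set xs \<subseteq> carrier G \<Longrightarrow> list_mult G xs \<in> carrier G"
  by (induction xs) auto

lemma list_mult_append:
  assumes "set xs \<subseteq> carrier G" and "set ys \<subseteq> carrier G"
  shows "list_mult G (xs @ ys) = list_mult G xs \<otimes> list_mult G ys"
  using assms by (induction xs) (auto simp: m_assoc)

text \<open>The substituted word has the same value in the monoid, so one constant \<open>L\<close>
  serves multiplication on either side.\<close>

lemma word_substitution:
  assumes "finite \<Sigma>" and \<Sigma>: "\<Sigma> \<subseteq> carrier G" and \<Delta>: "generates G \<Delta>"
  obtains L where "\<And>\<sigma>s. \<sigma>s \<in> lists \<Sigma> \<Longrightarrow>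
    \<exists>\<delta>s\<in>lists \<Delta>. list_mult G \<delta>s = list_mult G \<sigma>s \<and> length \<delta>s \<le> L * length \<sigma>s"
proof -
  have "\<exists>\<delta>s\<in>lists \<Delta>. g = list_mult G \<delta>s" if "g \<in> \<Sigma>" for g
    using subsetD[OF \<Sigma> that] \<Delta> by (simp add: generates_def)
  then obtain w where w: "\<And>g. g \<in> \<Sigma> \<Longrightarrow> w g \<in> lists \<Delta> \<and> g = list_mult G (w g)"
    by metis
  obtain L where L: "\<And>g. g \<in> \<Sigma> \<Longrightarrow> length (w g) \<le> L"
    using finite_nat_set_iff_bounded_le[of "(\<lambda>g. length (w g)) ` \<Sigma>"] \<open>finite \<Sigma>\<close> by auto
  have \<Delta>c: "set \<delta>s \<subseteq> carrier G" if "\<delta>s \<in> lists \<Delta>" for \<delta>s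
    using that \<Delta> by (auto simp: generates_def)
  \<comment> \<open>The substitution is \<open>concat (map w \<sigma>s)\<close>. In the induction,
    prepending a letter \<open>g\<close> prepends the block \<open>w g\<close>, which multiplies the
    value by \<open>g\<close> and adds at most \<open>L\<close> to the length.\<close>
  have "concat (map w \<sigma>s) \<in> lists \<Delta> \<and> list_mult G (concat (map w \<sigma>s)) = list_mult G \<sigma>s \<and>
        length (concat (map w \<sigma>s)) \<le> L * length \<sigma>s" if "\<sigma>s \<in> lists \<Sigma>" for \<sigma>s
    using that
  proof (induction \<sigma>s rule: lists.induct)
    case (Cons g \<sigma>s)
    then show ?case
      using w[of g] L[of g] list_mult_append[OF \<Delta>c \<Delta>c, of "w g" "concat (map w \<sigma>s)"]
      by simp
  qed simp
  then show thesis
    using that by blast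
qed

end

text \<open>A finite bound excludes the empty set, whose infimum is \<infinity>, and a nonempty set
  of extended naturals attains its infimum. This turns bounds on word distances into the existence
  of short words.\<close>

lemma Inf_length_le_iff:
  "Inf {enat (length xs) | xs. P xs} \<le> enat n \<longleftrightarrow> (\<exists>xs. P xs \<and> length xs \<le> n)"
proof
  assume le: "Inf {enat (length xs) | xs. P xs} \<le> enat n"
  then obtain xs where "P xs"
    by (fastforce simp: top_enat_def)
  then have "enat (length xs) \<in> {enat (length xs) | xs. P xs}"
    by blast
  from wellorder_InfI[OF this]
  have "Inf {enat (length xs) | xs. P xs} \<in> {enat (length xs) | xs. P xs}" .
  with le show "\<exists>xs. P xs \<and> length xs \<le> n"
    by auto
next
  assume "\<exists>xs. P xs \<and> length xs \<le> n"
  then show "Inf {enat (length xs) | xs. P xs} \<le> enat n"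
    by (auto intro: Inf_lower2)
qed

text \<open>The entourage of radius \<open>R\<close> for \<open>d\<close> lies in that of radius
  \<open>L * R\<close> for \<open>d'\<close>. Pairs at infinite distance lie in no entourage, so
  finite bounds suffice.\<close>

lemma coarse_family_subset:
  fixes d d' :: "'a \<Rightarrow> 'a \<Rightarrow> enat"
  assumes "\<And>x y n. d x y \<le> enat n \<Longrightarrow> d' x y \<le> enat (L * n)"
  shows "coarse_family X (\<lambda>x y. ennreal_of_enat (d x y))
       \<subseteq> coarse_family X (\<lambda>x y. ennreal_of_enat (d' x y))"
proof -
  have "ennreal_of_enat (d' x y) \<le> ennreal (real L * R)"
    if R: "R \<ge> 0" and le: "ennreal_of_enat (d x y) \<le> ennreal R" for x y R
  proof -
    \<comment> \<open>The value \<infinity> would embed as \<open>top\<close>, which exceeds every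
      \<open>ennreal R\<close>.\<close>
    obtain k where k: "d x y = enat k"
      using le by (cases "d x y") (auto simp: top_unique)
    have "real k \<le> R"
      using le R unfolding k by (simp add: ennreal_of_nat_eq_real_of_nat)
    \<comment> \<open>Taking \<open>n\<close> to be the exact distance \<open>k\<close> avoids
      rounding the real radius \<open>R\<close>.\<close>
    have "ennreal_of_enat (d' x y) \<le> ennreal_of_enat (enat (L * k))"
      using assms[of x y k] k by (simp only: ennreal_of_enat_le_iff)
    also have "\<dots> = ennreal (real L * real k)"
      by (simp only: ennreal_of_enat_enat ennreal_of_nat_eq_real_of_nat of_nat_mult)
    also have "\<dots> \<le> ennreal (real L * R)"
      using \<open>real k \<le> R\<close> by (intro ennreal_leI mult_left_mono) auto
    finally show ?thesis .
  qed
  then have "entourage X (\<lambda>x y. ennreal_of_enat (d x y)) R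
      \<subseteq> entourage X (\<lambda>x y. ennreal_of_enat (d' x y)) (real L * R)" if "R \<ge> 0" for R
    using that by (auto simp: entourage_def)
  then show ?thesis
    unfolding coarse_family_def
    by (smt (verit, best) Collect_mono mult_nonneg_nonneg of_nat_0_le_iff order_trans)
qed

lemma coarse_family_word_dist_subset:
  fixes M :: "('a, 'b) monoid_scheme"
  assumes "monoid M" and "finite \<Sigma>" and "generates M \<Sigma>" and "generates M \<Delta>"
  shows "coarse_family X (\<lambda>x y. ennreal_of_enat (left_word_dist M \<Sigma> x y))
       \<subseteq> coarse_family X (\<lambda>x y. ennreal_of_enat (left_word_dist M \<Delta> x y))" (is ?left)
    and "coarse_family X (\<lambda>x y. ennreal_of_enat (right_word_dist M \<Sigma> x y))
       \<subseteq> coarse_family X (\<lambda>x y. ennreal_of_enat (right_word_dist M \<Delta> x y))" (is ?right)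
proof -
  have \<Sigma>: "\<Sigma> \<subseteq> carrier M"
    using assms(3) by (simp add: generates_def)
  obtain L where L: "\<And>\<sigma>s. \<sigma>s \<in> lists \<Sigma> \<Longrightarrow>
      \<exists>\<delta>s\<in>lists \<Delta>. list_mult M \<delta>s = list_mult M \<sigma>s \<and> length \<delta>s \<le> L * length \<sigma>s"
    using monoid.word_substitution[OF assms(1,2) \<Sigma> assms(4)] by blast
  \<comment> \<open>The predicate \<open>P\<close> stands for \<open>y = x \<otimes> g\<close> or
    \<open>y = g \<otimes> x\<close> as a condition on the value \<open>g\<close> of a word, so one
    argument covers both distances.\<close>
  have transfer: "\<exists>\<delta>s. (\<delta>s \<in> lists \<Delta> \<and> P (list_mult M \<delta>s)) \<and> length \<delta>s \<le> L * n"
    if "\<exists>\<sigma>s. (\<sigma>s \<in> lists \<Sigma> \<and> P (list_mult M \<sigma>s)) \<and> length \<sigma>s \<le> n" for P n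
  proof -
    from that obtain \<sigma>s where \<sigma>s: "\<sigma>s \<in> lists \<Sigma>" "P (list_mult M \<sigma>s)" "length \<sigma>s \<le> n"
      by blast
    from L[OF \<sigma>s(1)] obtain \<delta>s where \<delta>s: "\<delta>s \<in> lists \<Delta>"
        "list_mult M \<delta>s = list_mult M \<sigma>s" "length \<delta>s \<le> L * length \<sigma>s"
      by blast
    have "length \<delta>s \<le> L * n"
      using \<delta>s(3) mult_le_mono2[OF \<sigma>s(3)] by (rule le_trans)
    with \<sigma>s(2) \<delta>s(1,2) show ?thesis
      by auto
  qed
  show ?left
    by (rule coarse_family_subset[where L = L])
       (unfold left_word_dist_def Inf_length_le_iff, rule transfer)
  show ?right
    by (rule coarse_family_subset[where L = L])
       (unfold right_word_dist_def Inf_length_le_iff, rule transfer)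
qed

theorem proposition2p3:
  fixes M :: "('a, 'b) monoid_scheme" and \<Sigma> \<Delta> :: "'a set"
  assumes "monoid M"
    and "finite \<Sigma>" and "generates M \<Sigma>"
    and "finite \<Delta>" and "generates M \<Delta>"
  shows "coarse_family (carrier M) (\<lambda>x y. ennreal_of_enat (left_word_dist M \<Sigma> x y))
       = coarse_family (carrier M) (\<lambda>x y. ennreal_of_enat (left_word_dist M \<Delta> x y)) \<and>
         coarse_family (carrier M) (\<lambda>x y. ennreal_of_enat (right_word_dist M \<Sigma> x y))
       = coarse_family (carrier M) (\<lambda>x y. ennreal_of_enat (right_word_dist M \<Delta> x y))"
  \<comment> \<open>Each reverse inclusion is the same lemma with \<Sigma> and \<Delta>
    exchanged.\<close>
  by (intro conjI equalityI coarse_family_word_dist_subset assms)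

end
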